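(* For every fixed value of $r$, the matrix $$M(E,r)=V(r)\begin{pmatrix}-\widetilde j_l(E,r)\,\widetilde y_l(E,r) & \widetilde y_l(E,r)^2\\[1mm] -\widetilde j_l(E,r)^2 & \widetilde j_l(E,r)\,\widetilde y_l(E,r)\end{pmatrix}$$ is analytic in the complex energy variable $E$.
   Context: Here $\mu$ is the reduced mass, $\hbar$ is the reduced Planck constant, $l$ is the orbital angular momentum quantum number, $r$ is the radial coordinate, $E$ is the complex energy, and $k=\sqrt{2\mu E/\hbar^2}$ is the complex momentum, so that $k^2=2\mu E/\hbar^2$. The potential $V(r)$ is a central potential, independent of $E$. It is assumed short-ranged: $\lim_{r\to\infty}V(r)=0$, sufficiently rapidly so that the asymptotic solutions of the radial equation $\left[\frac{d^2}{dr^2}+k^2-\frac{l(l+1)}{r^2}-V(r)\right]u_l(E,r)=0$ coincide with those of the free radial equation (the same equation with $V=0$). The functions $j_l(kr)$ and $y_l(kr)$ are the Riccati–Bessel and Riccati–Neumann functions, two linearly independent solutions of the free radial equation, with the power series $$j_l(kr)=\sqrt\pi\sum_{n=0}^\infty\frac{(-1)^n}{n!\,\Gamma(l+n+\frac32)}\left(\frac{kr}2\right)^{2n+l+1},\qquad y_l(kr)=\sum_{n=0}^\infty c_n (kr)^{2n-l},$$ where the $c_n$ are numerical coefficients independent of the energy. The reduced functions are defined by $j_l(kr)=k^{l+1}\,\widetilde j_l(E,r)$ and $y_l(kr)=k^{-l}\,\widetilde y_l(E,r)$, that is, $$\widetilde j_l(E,r)=\sqrt\pi\sum_{n=0}^\infty\frac{(-1)^n}{n!\,\Gamma(l+n+\frac32)}\left(\frac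 r2\right)^{2n+l+1}\left(\frac{2\mu E}{\hbar^2}\right)^n,\qquad \widetilde y_l(E,r)=\sum_{n=0}^\infty c_n\,r^{2n-l}\left(\frac{2\mu E}{\hbar^2}\right)^n .$$ The matrix $M(E,r)$ is the coefficient matrix of the first-order system $\partial_r X(E,r)=M(E,r)X(E,r)$, $X(E,0)=(1,0)^T$, where $X=(\widehat A_l,\widehat B_l)^T$. Here $\widehat A_l=A_l$ and $\widehat B_l=k^{-(2l+1)}B_l$, and $A_l,B_l$ are the variation-of-parameters coefficients of the regular solution (the solution with $u_l(E,0)=0$), written $u_l(E,r)=A_l(E,r)\,j_l(kr)-B_l(E,r)\,y_l(kr)$ with the auxiliary condition $\partial_rA_l\,j_l(kr)-\partial_rB_l\,y_l(kr)=0$ and the initial values $A_l(E,0)=1$, $B_l(E,0)=0$. *)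

theory Defs
  imports "HOL-Complex_Analysis.Complex_Analysis" "HOL-Real_Asymp.Real_Asymp"
begin

definition momentum :: "real \<Rightarrow> real \<Rightarrow> complex \<Rightarrow> complex" where
  "momentum \<mu> hbar E = csqrt (2 * of_real \<mu> * E / of_real (hbar\<^sup>2))"

definition riccati_bessel :: "nat \<Rightarrow> complex \<Rightarrow> complex" where
  "riccati_bessel l z = of_real (sqrt pi) *
     (\<Sum>n. (-1) ^ n / (fact n * Gamma (of_nat l + of_nat n + 3 / 2)) * (z / 2) ^ (2 * n + l + 1))"

text \<open>
  The Riccati--Neumann function is
  \<open>y\<^sub>l(z) = sqrt (\<pi> z / 2) Y\<^bsub>l+1/2\<^esub>(z) = (-1)\<^bsup>l+1\<^esup> sqrt (\<pi> z / 2) J\<^bsub>-l-1/2\<^esub>(z)\<close>,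
  normalised so that \<open>y\<^sub>0(z) = - cos z\<close> and the Wronskian \<open>j\<^sub>l y\<^sub>l' - j\<^sub>l' y\<^sub>l\<close> is 1.  Inserting the
  power series of \<open>J\<close> yields the coefficients below.  The argument of \<open>Gamma\<close> is a half-integer,
  so it is never a pole.
\<close>

definition neumann_coeff :: "nat \<Rightarrow> nat \<Rightarrow> real" where
  "neumann_coeff l n = (-1) ^ (n + l + 1) * sqrt pi /
     (fact n * Gamma (real n - real l + 1 / 2)) * (1 / 2) powi (2 * int n - int l)"

definition riccati_neumann :: "nat \<Rightarrow> complex \<Rightarrow> complex" where
  "riccati_neumann l z = (\<Sum>n. of_real (neumann_coeff l n) * z powi (2 * int n - int l))"

definition reduced_bessel :: "real \<Rightarrow> real \<Rightarrow> nat \<Rightarrow> complex \<Rightarrow> real \<Rightarrow> complex" where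
  "reduced_bessel \<mu> hbar l E r = of_real (sqrt pi) *
     (\<Sum>n. (-1) ^ n / (fact n * Gamma (of_nat l + of_nat n + 3 / 2)) *
        of_real ((r / 2) ^ (2 * n + l + 1)) * (2 * of_real \<mu> * E / of_real (hbar\<^sup>2)) ^ n)"

text \<open>
  For \<open>l \<ge> 1\<close> the next function is singular at \<open>r = 0\<close>; its value there is only the convention
  \<open>0 powi m = 0\<close> for negative \<open>m\<close>.
\<close>

definition reduced_neumann :: "real \<Rightarrow> real \<Rightarrow> nat \<Rightarrow> complex \<Rightarrow> real \<Rightarrow> complex" where
  "reduced_neumann \<mu> hbar l E r =
     (\<Sum>n. of_real (neumann_coeff l n * r powi (2 * int n - int l)) *
        (2 * of_real \<mu> * E / of_real (hbar\<^sup>2)) ^ n)"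

lemma summable_ratio_power:
  fixes a q :: "nat \<Rightarrow> complex" and x :: complex
  assumes step: "\<And>n. a (Suc n) = a n * q n" and q: "q \<longlonglongrightarrow> 0"
  shows "summable (\<lambda>n. a n * x ^ n)"
proof -
  have "(\<lambda>n. norm (q n * x)) \<longlonglongrightarrow> 0"
    by (rule tendsto_norm_zero, rule tendsto_mult_left_zero, rule q)
  then have "eventually (\<lambda>n. norm (q n * x) < 1 / 2) sequentially"
    by (rule order_tendstoD) simp
  then obtain N where N: "\<And>n. n \<ge> N \<Longrightarrow> norm (q n * x) < 1 / 2"
    by (auto simp: eventually_sequentially)
  show ?thesis
  proof (rule summable_ratio_test[of "1 / 2" N])
    fix n assume "n \<ge> N"
    then have "norm (q n * x) * norm (a n * x ^ n) \<le> 1 / 2 * norm (a n * x ^ n)"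
      by (intro mult_right_mono) (use N in \<open>auto intro: less_imp_le\<close>)
    then show "norm (a (Suc n) * x ^ Suc n) \<le> 1 / 2 * norm (a n * x ^ n)"
      by (simp add: step norm_mult mult_ac)
  qed simp
qed

lemma summable_bessel:
  "summable (\<lambda>n. (-1) ^ n / (fact n * Gamma (of_nat l + of_nat n + 3 / 2)) * x ^ n)"
  for x :: complex
proof (rule summable_ratio_power)
  fix n
  let ?z = "of_nat l + of_nat n + 3 / 2 :: complex"
  have re: "Re ?z > 0" by simp
  have "?z \<notin> \<int>\<^sub>\<le>\<^sub>0"
  proof
    assume "?z \<in> \<int>\<^sub>\<le>\<^sub>0"
    then obtain m where "?z = of_int m" "m \<le> 0" by (rule nonpos_Ints_cases)
    then have "Re ?z \<le> 0" by (metis complex_Re_of_int of_int_le_0_iff)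
    with re show False by linarith
  qed
  then have "Gamma (?z + 1) = ?z * Gamma ?z"
    by (intro Gamma_plus1)
  moreover have "of_nat l + of_nat (Suc n) + 3 / 2 = ?z + 1"
    by simp
  ultimately have G: "Gamma (of_nat l + of_nat (Suc n) + 3 / 2) = ?z * Gamma ?z"
    by metis
  show "(-1) ^ Suc n / (fact (Suc n) * Gamma (of_nat l + of_nat (Suc n) + 3 / 2)) =
        (-1) ^ n / (fact n * Gamma ?z) * (- 1 / (of_nat (Suc n) * ?z))"
    unfolding G by (simp add: mult_ac del: of_nat_Suc)
next
  have "(\<lambda>n. 1 / (real (Suc n) * (real l + real n + 3 / 2))) \<longlonglongrightarrow> 0"
    by real_asymp
  then have "(\<lambda>n. norm (- 1 / (of_nat (Suc n) * (of_nat l + of_nat n + 3 / 2)) :: complex)) \<longlonglongrightarrow> 0"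
  proof (rule Lim_transform_eventually, intro always_eventually allI)
    fix n
    have "(of_nat (Suc n) * (of_nat l + of_nat n + 3 / 2) :: complex) =
          of_real (real (Suc n) * (real l + real n + 3 / 2))"
      by simp
    then show "1 / (real (Suc n) * (real l + real n + 3 / 2)) =
      norm (- 1 / (of_nat (Suc n) * (of_nat l + of_nat n + 3 / 2)) :: complex)"
      by (simp only: norm_divide norm_of_real) simp
  qed
  then show "(\<lambda>n. - 1 / (of_nat (Suc n) * (of_nat l + of_nat n + 3 / 2)) :: complex) \<longlonglongrightarrow> 0"
    by (rule tendsto_norm_zero_cancel)
qed

lemma neumann_coeff_Suc:
  "neumann_coeff l (Suc n) =
     neumann_coeff l n * (- 1 / (4 * real (Suc n) * (real n - real l + 1 / 2)))"
proof -
  let ?x = "real n - real l + 1 / 2"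
  have "?x \<notin> \<int>"
  proof
    assume "?x \<in> \<int>"
    then obtain m where "?x = of_int m" by (auto elim: Ints_cases)
    then have "of_int (2 * m) = (of_int (2 * (int n - int l) + 1) :: real)" by simp
    then show False by (simp only: of_int_eq_iff) presburger
  qed
  then have "?x \<notin> \<int>\<^sub>\<le>\<^sub>0" using nonpos_Ints_subset_Ints by blast
  then have "Gamma (?x + 1) = ?x * Gamma ?x" by (intro Gamma_plus1)
  moreover have "real (Suc n) - real l + 1 / 2 = ?x + 1" by simp
  ultimately have G: "Gamma (real (Suc n) - real l + 1 / 2) = ?x * Gamma ?x" by metis
  have e: "2 * int (Suc n) - int l = (2 * int n - int l) + 2" by simp
  have q: "(1 / 2 :: real) powi 2 = 1 / 4" by (simp add: power_divide)
  have P: "(1 / 2 :: real) powi (2 * int (Suc n) - int l) =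
      (1 / 2) powi (2 * int n - int l) * (1 / 4)"
    unfolding e by (subst power_int_add) (simp_all only: q, simp)
  show ?thesis
    unfolding neumann_coeff_def G P by (simp add: mult_ac del: of_nat_Suc)
qed

lemma summable_neumann: "summable (\<lambda>n. of_real (neumann_coeff l n) * x ^ n)"
  for x :: complex
proof (rule summable_ratio_power)
  show "of_real (neumann_coeff l (Suc n)) = (of_real (neumann_coeff l n) *
      of_real (- 1 / (4 * real (Suc n) * (real n - real l + 1 / 2))) :: complex)" for n
    by (simp only: neumann_coeff_Suc of_real_mult)
  have "(\<lambda>n. - 1 / (4 * real (Suc n) * (real n - real l + 1 / 2))) \<longlonglongrightarrow> 0"
    by real_asymp
  then show "(\<lambda>n. of_real (- 1 / (4 * real (Suc n) * (real n - real l + 1 / 2))) :: complex)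
      \<longlonglongrightarrow> 0"
    by (rule tendsto_of_real[where a = 0, simplified of_real_0])
qed

lemma momentum_squared: "(momentum \<mu> hbar E)\<^sup>2 = 2 * of_real \<mu> * E / of_real (hbar\<^sup>2)"
  by (simp add: momentum_def)

lemma riccati_bessel_eq_reduced:
  "riccati_bessel l (momentum \<mu> hbar E * of_real r) =
     momentum \<mu> hbar E ^ (l + 1) * reduced_bessel \<mu> hbar l E r"
proof -
  let ?k = "momentum \<mu> hbar E"
  let ?b = "\<lambda>n. (-1) ^ n / (fact n * Gamma (of_nat l + of_nat n + 3 / 2)) :: complex"
  let ?f = "\<lambda>n. ?b n * of_real ((r / 2) ^ (2 * n + l + 1)) * (?k\<^sup>2) ^ n"
  have pow: "z ^ (2 * n + l + 1) = z ^ (l + 1) * (z\<^sup>2) ^ n" for n and z :: "'a :: comm_ring_1"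
    by (simp add: power_add power_mult)
  have "?f = (\<lambda>n. of_real ((r / 2) ^ (l + 1)) * (?b n * (of_real ((r / 2)\<^sup>2) * ?k\<^sup>2) ^ n))"
    unfolding pow of_real_mult of_real_power power_mult_distrib by (simp only: mult_ac)
  then have "summable ?f"
    by (simp only: summable_mult[OF summable_bessel])
  then have "(\<Sum>n. ?k ^ (l + 1) * ?f n) = ?k ^ (l + 1) * (\<Sum>n. ?f n)"
    by (rule suminf_mult)
  moreover have "?b n * (?k * of_real r / 2) ^ (2 * n + l + 1) = ?k ^ (l + 1) * ?f n" for n
  proof -
    have "?k * of_real r / 2 = ?k * of_real (r / 2)" by simp
    then show ?thesis
      by (simp only: pow of_real_mult of_real_power power_mult_distrib) (simp only: mult_ac)
  qed
  ultimately show ?thesis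
    unfolding riccati_bessel_def reduced_bessel_def momentum_squared[symmetric]
    by (simp only: mult.left_commute[of "of_real (sqrt pi)"])
qed

lemma riccati_neumann_eq_reduced:
  assumes "momentum \<mu> hbar E \<noteq> 0" and "r \<noteq> 0"
  shows "riccati_neumann l (momentum \<mu> hbar E * of_real r) =
     momentum \<mu> hbar E powi (- int l) * reduced_neumann \<mu> hbar l E r"
proof -
  let ?k = "momentum \<mu> hbar E"
  let ?f = "\<lambda>n. of_real (neumann_coeff l n * r powi (2 * int n - int l)) * (?k\<^sup>2) ^ n"
  have pow: "z powi (2 * int n - int l) = z powi (- int l) * (z\<^sup>2) ^ n"
    if "z \<noteq> 0" for n and z :: "'a :: field"
  proof -
    have "2 * int n - int l = - int l + int (2 * n)" by simp
    then show ?thesis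
      using that by (simp only: power_int_add power_int_of_nat power_mult simp_thms)
  qed
  have pow': "z powi (int n * 2 - int l) = z powi (- int l) * (z\<^sup>2) ^ n"
    if "z \<noteq> 0" for n and z :: "'a :: field"
    using pow[OF that, of n] by (simp add: mult.commute)
  have "?f = (\<lambda>n. of_real (r powi (- int l)) *
      (of_real (neumann_coeff l n) * (of_real (r\<^sup>2) * ?k\<^sup>2) ^ n))"
    using assms(2) by (simp add: fun_eq_iff pow' power_mult_distrib mult_ac)
  then have "summable ?f"
    by (simp only: summable_mult[OF summable_neumann])
  then have "(\<Sum>n. ?k powi (- int l) * ?f n) = ?k powi (- int l) * (\<Sum>n. ?f n)"
    by (rule suminf_mult)
  moreover have "of_real (neumann_coeff l n) * (?k * of_real r) powi (2 * int n - int l) =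
      ?k powi (- int l) * ?f n" for n
    using assms by (simp add: pow' power_mult_distrib power_int_mult_distrib mult_ac)
  ultimately show ?thesis
    unfolding riccati_neumann_def reduced_neumann_def momentum_squared[symmetric]
    by presburger
qed

definition system_matrix ::
    "real \<Rightarrow> real \<Rightarrow> nat \<Rightarrow> (real \<Rightarrow> complex) \<Rightarrow> complex \<Rightarrow> real \<Rightarrow> complex ^ 2 ^ 2" where
  "system_matrix \<mu> hbar l V E r =
     (let j = reduced_bessel \<mu> hbar l E r; y = reduced_neumann \<mu> hbar l E r
      in vector [vector [V r * (- (j * y)), V r * y\<^sup>2],
                 vector [V r * (- (j\<^sup>2)),    V r * (j * y)]])"

end

theory Submission
  imports Defs
begin

text \<open>
  Each entry is a polynomial in the two reduced functions, and these are power series in \<open>E\<close>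
  (for fixed \<open>r\<close>) that converge everywhere: the factorial and the \<open>Gamma\<close> function in the
  denominators beat the geometric growth of the powers of \<open>r\<close>.
\<close>

text \<open>Termwise differentiation gives a complex derivative at every point, and on an open set
  holomorphic means analytic.\<close>

lemma analytic_everywhere_convergent_powser:
  fixes a :: "nat \<Rightarrow> complex"
  assumes "\<And>x. summable (\<lambda>n. a n * x ^ n)"
  shows "(\<lambda>x. \<Sum>n. a n * x ^ n) analytic_on UNIV"
  using termdiffs_strong_converges_everywhere[OF assms]
  by (auto simp: analytic_on_open holomorphic_on_open)

text \<open>Meant for \<open>g E\<close> = k^2, which is linear in \<open>E\<close>; the branch cut
  of k itself never enters.\<close>

lemma analytic_everywhere_convergent_powser_compose:
  fixes a :: "nat \<Rightarrow> complex"
  assumes "\<And>x. summable (\<lambda>n. a n * x ^ n)" and "g analytic_on S"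
  shows "(\<lambda>z. \<Sum>n. a n * g z ^ n) analytic_on S"
  using analytic_on_compose_gen[OF assms(2)
      analytic_everywhere_convergent_powser[OF assms(1)]]
  by (simp add: o_def)

text \<open>Up to a constant factor this is the series of \<open>summable_bessel\<close> at the
  rescaled point (r/2)^2 * x.\<close>

lemma summable_reduced_bessel:
  fixes x :: complex
  shows "summable (\<lambda>n. (-1) ^ n / (fact n * Gamma (of_nat l + of_nat n + 3 / 2)) *
    of_real ((r / 2) ^ (2 * n + l + 1)) * x ^ n)" (is "summable ?f")
proof -
  let ?b = "\<lambda>n. (-1) ^ n / (fact n * Gamma (of_nat l + of_nat n + 3 / 2)) :: complex"
  have pow: "z ^ (2 * n + l + 1) = z ^ (l + 1) * (z\<^sup>2) ^ n" for n and z :: real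
    by (simp add: power_add power_mult)
  have "?f = (\<lambda>n. of_real ((r / 2) ^ (l + 1)) * (?b n * (of_real ((r / 2)\<^sup>2) * x) ^ n))"
    unfolding pow of_real_mult of_real_power power_mult_distrib by (simp only: mult_ac)
  then show ?thesis
    by (simp only: summable_mult[OF summable_bessel])
qed

lemma summable_reduced_neumann:
  fixes x :: complex
  shows "summable (\<lambda>n. of_real (neumann_coeff l n * r powi (2 * int n - int l)) * x ^ n)"
    (is "summable ?f")
proof (cases "r = 0")
  case True
  \<comment> \<open>Since \<open>0 powi m = 0\<close> also for negative \<open>m\<close>, only the term with \<open>2 * n = l\<close> survives.\<close>
  show ?thesis
  proof (rule summable_finite[of "{..l}"])
    fix n assume "n \<notin> {..l}"
    then show "?f n = 0"
      using True by (simp add: power_int_0_left_if)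
  qed simp
next
  case False
  \<comment> \<open>This splitting fails at \<open>r = 0\<close>: for \<open>l = 2\<close>,
    \<open>n = 1\<close> the left side is 1 and the right side 0.\<close>
  have pow: "r powi (2 * int n - int l) = r powi (- int l) * (r\<^sup>2) ^ n" for n
  proof -
    have "2 * int n - int l = - int l + int (2 * n)" by simp
    then show ?thesis
      using False by (simp only: power_int_add power_int_of_nat power_mult simp_thms)
  qed
  have "?f = (\<lambda>n. of_real (r powi (- int l)) *
      (of_real (neumann_coeff l n) * (of_real (r\<^sup>2) * x) ^ n))"
    unfolding pow of_real_mult of_real_power power_mult_distrib by (simp only: mult_ac)
  then show ?thesis
    by (simp only: summable_mult[OF summable_neumann])
qed

lemma analytic_energy: "(\<lambda>E. 2 * of_real \<mu> * E / of_real (hbar\<^sup>2) :: complex) analytic_on S"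
  \<comment> \<open>As a product with a constant inverse, the quotient needs no nonzero
    denominator.\<close>
  unfolding divide_inverse by (intro analytic_intros)

lemma analytic_reduced_bessel: "(\<lambda>E. reduced_bessel \<mu> hbar l E r) analytic_on S"
  unfolding reduced_bessel_def
  by (intro analytic_on_mult analytic_on_const analytic_energy
      analytic_everywhere_convergent_powser_compose summable_reduced_bessel)

lemma analytic_reduced_neumann: "(\<lambda>E. reduced_neumann \<mu> hbar l E r) analytic_on S"
  unfolding reduced_neumann_def
  by (intro analytic_energy analytic_everywhere_convergent_powser_compose
      summable_reduced_neumann)

theorem proposition1:
  fixes \<mu> hbar :: real and l :: nat and V :: "real \<Rightarrow> complex" and r :: real
  assumes "\<mu> > 0" and "hbar > 0"
    and "(V \<longlongrightarrow> 0) at_top"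
    and "r \<ge> 0"
  shows "\<forall>i j. (\<lambda>E. system_matrix \<mu> hbar l V E r $ i $ j) analytic_on UNIV"
  unfolding forall_2 system_matrix_def Let_def vector_2
  by (intro conjI analytic_on_mult analytic_on_neg analytic_on_power analytic_on_const
      analytic_reduced_bessel analytic_reduced_neumann)

end
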